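(* Let $B\subset (0,1)$ be closed and invariant under multiplication by $2$ (mod $1$). If $B$ is invariant for some QMF function $p$, then there is a QMF function $\tilde p$ such that $B$ is invariant for $\tilde p$ and $$\mathbb{P}_{\tilde p}\big(\xi_t\to 0 \text{ or } 1 \,\big|\, \xi_0\big)=1 \quad\text{for Lebesgue a.e. } \xi_0\in[0,1].$$
   Context: A QMF function is a nonnegative, continuous, $1$-periodic function $p:\mathbb{R}\to\mathbb{R}$ satisfying $p(\xi/2)+p(\xi/2+1/2)=1$ for every $\xi\in[0,1]$ and $p(0)=1$. To each QMF function $p$ one associates the Markov process $\xi_0,\xi_1,\xi_2,\dots$ on $[0,1]$ which, given $\xi_0\in[0,1]$, evolves by $\xi_{t+1}\in\{\xi_t/2,\ \xi_t/2+1/2\}$ with $\mathbb{P}_p(\xi_{t+1}=\xi_t/2+j/2\mid \xi_t)=p(\xi_t/2+j/2)$ for $j=0,1$. Here $\mathbb{P}_p(\,\cdot\mid\xi_0)$ is the law of the process started at $\xi_0$. The event "$\xi_t\to 0$ or $1$" means that, as $t\to\infty$, the sequence $(\xi_t)$ converges to $0$ or converges to $1$. A set $B\subset[0,1]$ is invariant for $p$ if $\mathbb{P}_p(\xi_1\in B\mid\xi_0)=1$ for every $\xi_0\in B$. A set $B\subset(0,1)$ is invariant under multiplication by $2$ (mod $1$) if, regarded as a subset of the circle $[0,1)$, it satisfies $B=\theta(B)$, where $\theta(\xi)=2\xi$ (mod $1$). "Closed" means closed as a subset of $\mathbb{R}$ (equivalently, of $[0,1]$). *)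

theory Defs
  imports "HOL-Probability.Probability"
begin

definition QMF :: "(real \<Rightarrow> real) \<Rightarrow> bool" where
  "QMF p \<longleftrightarrow> (\<forall>\<xi>. p \<xi> \<ge> 0) \<and> continuous_on UNIV p \<and> (\<forall>\<xi>. p (\<xi> + 1) = p \<xi>) \<and>
     (\<forall>\<xi>\<in>{0..1}. p (\<xi> / 2) + p (\<xi> / 2 + 1 / 2) = 1) \<and> p 0 = 1"

text \<open>The one-step transition law from \<^term>\<open>\<xi>\<close>.  For a QMF function the two weights add up to one
  for every real \<^term>\<open>\<xi>\<close> (lemma \<open>QMF_sum\<close>), so the transition law is defined on the whole
  real line, and it maps the unit interval to itself.\<close>

definition qmf_step :: "(real \<Rightarrow> real) \<Rightarrow> real \<Rightarrow> real pmf" where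
  "qmf_step p \<xi> = pmf_of_list [(\<xi> / 2, p (\<xi> / 2)), (\<xi> / 2 + 1 / 2, p (\<xi> / 2 + 1 / 2))]"

text \<open>The conditional law of the state at time \<^term>\<open>n\<close> given the states \<^term>\<open>\<omega>\<close> at the earlier times,
  for the process started at \<^term>\<open>x\<close>.\<close>

definition qmf_kernel :: "(real \<Rightarrow> real) \<Rightarrow> real \<Rightarrow> nat \<Rightarrow> (nat \<Rightarrow> real) \<Rightarrow> real measure" where
  "qmf_kernel p x n \<omega> =
     measure_pmf (case n of 0 \<Rightarrow> return_pmf x | Suc t \<Rightarrow> qmf_step p (\<omega> t))"

text \<open>The law on trajectories is the Ionescu-Tulcea measure of these kernels.  All transition laws
  are finitely supported, so each coordinate carries the discrete \<open>\<sigma>\<close>-algebra: every set of states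
  is an event, and the \<open>\<sigma>\<close>-algebra on trajectories contains the Borel product \<open>\<sigma>\<close>-algebra.
  Lemma \<open>qmf_law_cylinder\<close> gives the finite-dimensional distributions.\<close>

definition qmf_law :: "(real \<Rightarrow> real) \<Rightarrow> real \<Rightarrow> (nat \<Rightarrow> real) measure" where
  "qmf_law p x = projective_family.lim UNIV
     (Ionescu_Tulcea.CI (qmf_kernel p x) (\<lambda>_. count_space UNIV)) (\<lambda>_. count_space UNIV)"

definition qmf_invariant :: "(real \<Rightarrow> real) \<Rightarrow> real set \<Rightarrow> bool" where
  "qmf_invariant p B \<longleftrightarrow> B \<subseteq> {0..1} \<and> (\<forall>x\<in>B. \<P>(\<xi> in qmf_law p x. \<xi> 1 \<in> B) = 1)"

definition mult2_invariant :: "real set \<Rightarrow> bool" where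
  "mult2_invariant B \<longleftrightarrow> (\<lambda>\<xi>. frac (2 * \<xi>)) ` B = B"

lemma QMF_sum:
  assumes "QMF p"
  shows "p (x / 2) + p (x / 2 + 1 / 2) = 1"
proof -
  have per: "p (y + 1) = p y" for y
    using assms by (simp add: QMF_def)
  define g where "g y = p (y / 2) + p (y / 2 + 1 / 2)" for y
  have g1: "g (y + 1) = g y" for y
  proof -
    have e: "(y + 1) / 2 + 1 / 2 = y / 2 + 1"
      by (simp add: field_simps)
    have "(y + 1) / 2 = y / 2 + 1 / 2"
      by (simp add: field_simps)
    then have "p ((y + 1) / 2) = p (y / 2 + 1 / 2)"
      by (rule arg_cong)
    then show ?thesis
      unfolding g_def e per by simp
  qed
  have gn: "g (y + real n) = g y" for y n
  proof (induction n)
    case (Suc n)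
    have "y + real (Suc n) = (y + real n) + 1"
      by simp
    with Suc g1[of "y + real n"] show ?case
      by (simp only:)
  qed simp
  have "g (y + of_int k) = g y" for y k
  proof (cases "k \<ge> 0")
    case True
    then show ?thesis
      using gn[of y "nat k"] by simp
  next
    case False
    then show ?thesis
      using gn[of "y + of_int k" "nat (- k)"] by simp
  qed
  from this[of "frac x" "\<lfloor>x\<rfloor>"] have "g x = g (frac x)"
    by (simp add: frac_def)
  also have "\<dots> = 1"
    using assms frac_ge_0[of x] frac_lt_1[of x] by (auto simp: g_def QMF_def)
  finally show ?thesis
    by (simp add: g_def)
qed

lemma pmf_qmf_step:
  assumes "QMF p"
  shows "pmf (qmf_step p x) (x / 2) = p (x / 2)"
    and "pmf (qmf_step p x) (x / 2 + 1 / 2) = p (x / 2 + 1 / 2)"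
proof -
  have "pmf_of_list_wf [(x / 2, p (x / 2)), (x / 2 + 1 / 2, p (x / 2 + 1 / 2))]"
    using assms QMF_sum[OF assms, of x] by (intro pmf_of_list_wfI) (auto simp: QMF_def)
  then show "pmf (qmf_step p x) (x / 2) = p (x / 2)"
    and "pmf (qmf_step p x) (x / 2 + 1 / 2) = p (x / 2 + 1 / 2)"
    by (simp_all add: qmf_step_def pmf_pmf_of_list)
qed

lemma Ionescu_Tulcea_qmf_kernel: "Ionescu_Tulcea (qmf_kernel p x) (\<lambda>_. count_space UNIV)"
proof (rule Ionescu_Tulcea.intro)
  show "qmf_kernel p x i \<in> Pi\<^sub>M {0..<i} (\<lambda>_. count_space UNIV) \<rightarrow>\<^sub>M subprob_algebra (count_space UNIV)" for i
  proof (cases i)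
    case 0
    then show ?thesis
      by (simp add: qmf_kernel_def[abs_def] space_subprob_algebra measure_pmf.subprob_space_axioms)
  next
    case (Suc t)
    have "(\<lambda>\<omega>. \<omega> t) \<in> Pi\<^sub>M {0..<i} (\<lambda>_. count_space UNIV) \<rightarrow>\<^sub>M count_space (UNIV :: real set)"
      using Suc by (intro measurable_component_singleton) simp
    moreover have "(\<lambda>y. measure_pmf (qmf_step p y)) \<in> count_space UNIV \<rightarrow>\<^sub>M subprob_algebra (count_space UNIV)"
      by (simp add: space_subprob_algebra measure_pmf.subprob_space_axioms)
    ultimately show ?thesis
      using Suc by (auto simp: qmf_kernel_def[abs_def] intro: measurable_compose)
  qed
qed (simp add: qmf_kernel_def measure_pmf.prob_space_axioms)

interpretation qmf: Ionescu_Tulcea "qmf_kernel p x" "\<lambda>_. count_space UNIV" for p x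
  by (rule Ionescu_Tulcea_qmf_kernel)

lemma sets_qmf_law: "sets (qmf_law p x) = sets (Pi\<^sub>M UNIV (\<lambda>_. count_space UNIV))"
  unfolding qmf_law_def by (rule qmf.PF.sets_lim)

lemma prob_space_qmf_law: "prob_space (qmf_law p x)"
proof (rule prob_space_distrD)
  show "(\<lambda>\<omega>. restrict \<omega> {}) \<in> qmf_law p x \<rightarrow>\<^sub>M Pi\<^sub>M {} (\<lambda>_. count_space (UNIV :: real set))"
    by (intro measurable_restrict) simp
  show "prob_space (distr (qmf_law p x) (Pi\<^sub>M {} (\<lambda>_. count_space UNIV)) (\<lambda>\<omega>. restrict \<omega> {}))"
    unfolding qmf_law_def by (subst qmf.distr_lim) (simp_all add: qmf.PF.prob_space_P)
qed

lemma qmf_law_cylinder: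
  "\<P>(\<xi> in qmf_law p x. \<forall>t\<le>n. \<xi> t = z t) =
     (if z 0 = x then \<Prod>t<n. pmf (qmf_step p (z t)) (z (Suc t)) else 0)"
proof -
  let ?M = "\<lambda>_::nat. count_space (UNIV :: real set)"
  let ?z = "\<lambda>m. restrict z {0..<m}"
  have sing: "{?z m} \<in> sets (Pi\<^sub>M {0..<m} ?M)" for m
  proof -
    have "Pi\<^sub>E {0..<m} (\<lambda>i. {z i}) \<in> sets (Pi\<^sub>M {0..<m} ?M)"
      by (intro sets_PiM_I_finite) auto
    moreover have "Pi\<^sub>E {0..<m} (\<lambda>i. {z i}) = {?z m}"
      by (auto simp: PiE_iff extensional_def fun_eq_iff)
    ultimately show ?thesis
      by simp
  qed
  have step: "emeasure (qmf.C p x 0 (Suc m) (\<lambda>_. undefined)) {?z (Suc m)} =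
      emeasure (qmf.C p x 0 m (\<lambda>_. undefined)) {?z m} * emeasure (qmf_kernel p x m (?z m)) {z m}" for m
  proof -
    have sp: "space (qmf.C p x 0 m (\<lambda>_. undefined)) = space (Pi\<^sub>M {0..<m} ?M)"
      by (subst qmf.space_C) (auto simp: space_PiM)
    have st: "sets (qmf.C p x 0 m (\<lambda>_. undefined)) = sets (Pi\<^sub>M {0..<m} ?M)"
      by (subst qmf.sets_C) (auto simp: space_PiM)
    have "emeasure (qmf.C p x 0 (Suc m) (\<lambda>_. undefined)) {?z (Suc m)} =
      (\<integral>\<^sup>+\<omega>. emeasure (qmf.eP p x m \<omega>) {?z (Suc m)} \<partial>qmf.C p x 0 m (\<lambda>_. undefined))"
      using sing[of "Suc m"] qmf.measurable_eP[of p x m]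
      unfolding qmf.C.simps add_0
      by (intro emeasure_bind[where N = "Pi\<^sub>M {0..<Suc m} ?M"])
         (simp_all add: sp space_PiM_empty_iff measurable_cong_sets[OF st refl])
    also have "\<dots> = (\<integral>\<^sup>+\<omega>. emeasure (qmf_kernel p x m (?z m)) {z m} * indicator {?z m} \<omega>
        \<partial>qmf.C p x 0 m (\<lambda>_. undefined))"
    proof (rule nn_integral_cong)
      fix \<omega> assume "\<omega> \<in> space (qmf.C p x 0 m (\<lambda>_. undefined))"
      then have \<omega>: "\<omega> \<in> space (Pi\<^sub>M {0..<m} ?M)"
        by (simp add: sp)
      then have ext: "\<omega> i = undefined" if "i \<ge> m" for i
        using that by (auto simp: space_PiM PiE_iff extensional_def)
      have eq: "fun_upd \<omega> m y = ?z (Suc m) \<longleftrightarrow> \<omega> = ?z m \<and> y = z m" for y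
      proof
        assume *: "fun_upd \<omega> m y = ?z (Suc m)"
        have "\<omega> i = ?z m i" for i
          using fun_cong[OF *, of i] ext[of i] by (cases "i < m") (auto split: if_splits)
        moreover have "y = z m"
          using fun_cong[OF *, of m] by simp
        ultimately show "\<omega> = ?z m \<and> y = z m"
          by auto
      qed (auto simp: fun_eq_iff)
      have "emeasure (qmf.eP p x m \<omega>) {?z (Suc m)} =
          emeasure (qmf_kernel p x m \<omega>) {y. fun_upd \<omega> m y = ?z (Suc m)}"
        by (subst qmf.emeasure_eP[OF \<omega> sing]) (simp add: vimage_def)
      also have "\<dots> = emeasure (qmf_kernel p x m (?z m)) {z m} * indicator {?z m} \<omega>"
        unfolding eq by (cases "\<omega> = ?z m") simp_all
      finally show "emeasure (qmf.eP p x m \<omega>) {?z (Suc m)} =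
          emeasure (qmf_kernel p x m (?z m)) {z m} * indicator {?z m} \<omega>" .
    qed
    also have "\<dots> = emeasure (qmf.C p x 0 m (\<lambda>_. undefined)) {?z m} * emeasure (qmf_kernel p x m (?z m)) {z m}"
      using sing[of m] by (subst nn_integral_cmult_indicator) (simp_all only: st mult.commute)
    finally show ?thesis .
  qed
  have C: "emeasure (qmf.C p x 0 (Suc m) (\<lambda>_. undefined)) {?z (Suc m)} =
      ennreal (if z 0 = x then \<Prod>t<m. pmf (qmf_step p (z t)) (z (Suc t)) else 0)" for m
  proof (induction m)
    case 0
    have "emeasure (qmf.C p x 0 0 (\<lambda>_. undefined)) {?z 0} = 1"
      using sing[of 0] by (simp add: restrict_def)
    then show ?case
      unfolding step[of 0]
      by (auto simp: qmf_kernel_def emeasure_pmf_single indicator_def)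
  next
    case (Suc m)
    show ?case
      unfolding step[of "Suc m"] Suc.IH
      by (simp add: qmf_kernel_def emeasure_pmf_single ennreal_mult[symmetric] prod_nonneg mult.commute)
  qed
  have "{\<xi> \<in> space (qmf_law p x). \<forall>t\<le>n. \<xi> t = z t} = qmf.PF.emb UNIV {0..<Suc n} {?z (Suc n)}"
    unfolding sets_eq_imp_space_eq[OF sets_qmf_law]
    by (auto simp: prod_emb_def space_PiM restrict_def fun_eq_iff less_Suc_eq_le split: if_splits)
  moreover have "emeasure (qmf_law p x) (qmf.PF.emb UNIV {0..<Suc n} {?z (Suc n)}) =
      emeasure (qmf.CI p x {0..<Suc n}) {?z (Suc n)}"
    unfolding qmf_law_def using sing by (intro qmf.lim) auto
  moreover have "\<dots> = emeasure (qmf.C p x 0 (Suc n) (\<lambda>_. undefined)) {?z (Suc n)}"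
    using sing[of "Suc n"] sets.sets_into_space[OF sing[of "Suc n"]]
    by (subst qmf.emeasure_CI[of _ "Suc n"]) (auto simp: prod_emb_id)
  ultimately show ?thesis
    unfolding C by (simp add: measure_def prod_nonneg)
qed

end

theory Submission
  imports Defs
begin

text \<open>The function \<open>p\<close> is kept on the preimages of \<open>B\<close>, which preserves invariance, and elsewhere
  it is blended with the clipped cosine, which is 1 near 0 and 0 near 1/2. The weight \<open>g\<close> of the cosine is a
  function of the distance \<open>d\<close> to \<open>B\<close> on the circle; it vanishes on \<open>B\<close>, equals 1 near the integers, where the
  process is therefore absorbed, and decays only like \<open>(log (1 / d)) powr (- 1 / N)\<close> near \<open>B\<close>. Doubling expands
  distances by at most 2, so after \<open>t\<close> steps the process started outside \<open>B\<close> is still at distance at least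
  \<open>2 ^ (- t) * d\<close> from \<open>B\<close>. Always stepping towards the nearest integer, it is absorbed within \<open>N\<close> further steps
  with probability at least a constant times \<open>1 / t\<close>. The harmonic series diverges, so absorption is almost
  sure from every point outside \<open>B\<close>; and \<open>B\<close> is a null set.\<close>

section \<open>Path expansion of the trajectory law\<close>

text \<open>A transition prepends a binary digit to the state, so a digit list codes a finite
  trajectory. Beyond the end of the list the value is the default 0; a path is thus a full sequence,
  to which predicates on trajectories apply directly.\<close>

fun digit_path :: "real \<Rightarrow> bool list \<Rightarrow> nat \<Rightarrow> real" where
  "digit_path x bs 0 = x"
| "digit_path x [] (Suc t) = 0"
| "digit_path x (b # bs) (Suc t) = digit_path (x / 2 + of_bool b / 2) bs t"

fun path_weight :: "(real \<Rightarrow> real) \<Rightarrow> real \<Rightarrow> bool list \<Rightarrow> real" where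
  "path_weight p x [] = 1"
| "path_weight p x (b # bs) = p (x / 2 + of_bool b / 2) * path_weight p (x / 2 + of_bool b / 2) bs"

lemma finite_length_bool: "finite {bs :: bool list. length bs = n \<and> P bs}"
  by (rule finite_subset[OF _ finite_lists_length_eq[of UNIV n]]) auto

lemma sum_length_Suc_bool:
  "(\<Sum>bs | length bs = Suc n \<and> P bs. f bs) =
    (\<Sum>bs | length bs = n \<and> P (False # bs). f (False # bs)) +
    (\<Sum>bs | length bs = n \<and> P (True # bs). f (True # bs) :: real)"
proof -
  let ?A = "\<lambda>b. {bs. length bs = n \<and> P (b # bs)}"
  have eq: "{bs. length bs = Suc n \<and> P bs} = Cons False ` ?A False \<union> Cons True ` ?A True"
  proof (intro set_eqI iffI)
    fix bs assume "bs \<in> {bs. length bs = Suc n \<and> P bs}"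
    then obtain b cs where "bs = b # cs" "length cs = n" "P (b # cs)"
      by (cases bs) auto
    then show "bs \<in> Cons False ` ?A False \<union> Cons True ` ?A True"
      by (cases b) auto
  qed auto
  show ?thesis
    unfolding eq by (subst sum.union_disjoint) (auto simp: finite_length_bool sum.reindex)
qed

lemma QMF_nonneg: "QMF p \<Longrightarrow> p x \<ge> 0"
  by (simp add: QMF_def)

lemma QMF_periodic: "QMF p \<Longrightarrow> p (x + 1) = p x"
  by (simp add: QMF_def)

lemma path_weight_nonneg: "QMF p \<Longrightarrow> path_weight p x bs \<ge> 0"
  by (induction bs arbitrary: x) (auto simp: QMF_nonneg)

lemma sum_path_weight:
  assumes "QMF p"
  shows "(\<Sum>bs | length bs = n. path_weight p x bs) = 1"
proof (induction n arbitrary: x)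
  case (Suc n)
  then show ?case
    using sum_length_Suc_bool[where n = n and P = "\<lambda>_. True"] QMF_sum[OF assms, of x]
    by (simp add: sum_distrib_left[symmetric])
qed simp

lemma prod_pmf_path:
  assumes "QMF p"
  shows "(\<Prod>t<length bs. pmf (qmf_step p (digit_path x bs t)) (digit_path x bs (Suc t))) = path_weight p x bs"
proof (induction bs arbitrary: x)
  case (Cons b bs)
  have "pmf (qmf_step p x) (x / 2 + of_bool b / 2) = p (x / 2 + of_bool b / 2)"
    using pmf_qmf_step[OF assms, of x] by (cases b) auto
  with Cons show ?case
    by (simp add: prod.lessThan_Suc_shift del: prod.lessThan_Suc)
qed simp

lemma path_step:
  "t < length bs \<Longrightarrow> digit_path x bs (Suc t) = digit_path x bs t / 2 + of_bool (bs ! t) / 2"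
proof (induction bs arbitrary: x t)
  case (Cons b bs)
  then show ?case
    by (cases t) auto
qed simp

text \<open>The factors are nonnegative, so a positive product has only positive factors. This later
  rules out transitions of probability 0.\<close>

lemma path_weight_pos_step:
  assumes "QMF p" "path_weight p x bs > 0" "t < length bs"
  shows "p (digit_path x bs (Suc t)) > 0"
  using assms(2,3)
proof (induction bs arbitrary: x t)
  case (Cons b bs)
  have "p (x / 2 + of_bool b / 2) > 0" "path_weight p (x / 2 + of_bool b / 2) bs > 0"
    using Cons.prems(1) QMF_nonneg[OF assms(1), of "x / 2 + of_bool b / 2"]
      path_weight_nonneg[OF assms(1), of "x / 2 + of_bool b / 2" bs]
    by (auto simp: zero_less_mult_iff)
  with Cons show ?case
    by (cases t) auto
qed simp

text \<open>The two successors of a state differ by 1/2, so the first differing digit separates the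
  paths. Hence distinct digit lists give disjoint cylinders.\<close>

lemma path_eq_imp_eq:
  assumes "length bs = length cs" "\<And>t. t \<le> length bs \<Longrightarrow> digit_path x bs t = digit_path x cs t"
  shows "bs = cs"
  using assms
proof (induction bs cs arbitrary: x rule: list_induct2)
  case (Cons b bs c cs)
  from Cons.prems[of 1] have [simp]: "b = c"
    by (cases b; cases c) auto
  have "bs = cs"
    using Cons.prems[of "Suc t" for t] by (intro Cons.IH) auto
  then show ?case
    by simp
qed simp

section \<open>Probabilities of events decided by finitely many coordinates\<close>

lemma finite_measure_qmf_law: "finite_measure (qmf_law p x)"
  using prob_space_qmf_law by (rule prob_space.finite_measure)

lemma measurable_qmf_law_coord: "(\<lambda>\<xi>. \<xi> t) \<in> qmf_law p x \<rightarrow>\<^sub>M count_space UNIV"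
  by (subst measurable_cong_sets[OF sets_qmf_law refl]) (rule measurable_component_singleton, simp)

lemma sets_qmf_law_coord: "{\<xi> \<in> space (qmf_law p x). \<xi> t \<in> A} \<in> sets (qmf_law p x)"
proof -
  have "(\<lambda>\<xi>. \<xi> t) -` A \<inter> space (qmf_law p x) \<in> sets (qmf_law p x)"
    by (rule measurable_sets[OF measurable_qmf_law_coord]) simp
  also have "(\<lambda>\<xi>. \<xi> t) -` A \<inter> space (qmf_law p x) = {\<xi> \<in> space (qmf_law p x). \<xi> t \<in> A}"
    by blast
  finally show ?thesis .
qed

lemma sets_qmf_law_coords:
  "{\<xi> \<in> space (qmf_law p x). \<forall>t\<le>n. \<xi> t \<in> A t} \<in> sets (qmf_law p x)"
proof -
  have "{\<xi> \<in> space (qmf_law p x). \<forall>t\<in>{..n}. \<xi> t \<in> A t} \<in> sets (qmf_law p x)"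
    by (intro sets.sets_Collect_finite_All sets_qmf_law_coord finite_atMost)
  then show ?thesis
    by (simp only: Ball_def atMost_iff)
qed

lemma prob_path:
  assumes "QMF p"
  shows "\<P>(\<xi> in qmf_law p x. \<forall>t\<le>length bs. \<xi> t = digit_path x bs t) = path_weight p x bs"
  unfolding qmf_law_cylinder prod_pmf_path[OF assms] by simp

lemma prob_paths:
  assumes "QMF p"
  shows "{\<xi> \<in> space (qmf_law p x). \<exists>bs. length bs = n \<and> Q bs \<and> (\<forall>t\<le>n. \<xi> t = digit_path x bs t)} \<in> sets (qmf_law p x)"
    and "\<P>(\<xi> in qmf_law p x. \<exists>bs. length bs = n \<and> Q bs \<and> (\<forall>t\<le>n. \<xi> t = digit_path x bs t)) =
      (\<Sum>bs | length bs = n \<and> Q bs. path_weight p x bs)"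
proof -
  let ?C = "\<lambda>bs. {\<xi> \<in> space (qmf_law p x). \<forall>t\<le>n. \<xi> t = digit_path x bs t}"
  have sets: "?C bs \<in> sets (qmf_law p x)" for bs
    using sets_qmf_law_coords[of p x n "\<lambda>t. {digit_path x bs t}"] unfolding singleton_iff .
  have eq: "{\<xi> \<in> space (qmf_law p x). \<exists>bs. length bs = n \<and> Q bs \<and> (\<forall>t\<le>n. \<xi> t = digit_path x bs t)} =
    (\<Union>bs\<in>{bs. length bs = n \<and> Q bs}. ?C bs)"
    by auto
  show "{\<xi> \<in> space (qmf_law p x). \<exists>bs. length bs = n \<and> Q bs \<and> (\<forall>t\<le>n. \<xi> t = digit_path x bs t)} \<in> sets (qmf_law p x)"
    unfolding eq by (intro sets.finite_UN finite_length_bool sets)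
  have "disjoint_family_on ?C {bs. length bs = n \<and> Q bs}"
    unfolding disjoint_family_on_def
  proof (intro ballI impI, rule ccontr)
    fix bs cs assume *: "bs \<in> {bs. length bs = n \<and> Q bs}" "cs \<in> {bs. length bs = n \<and> Q bs}" "bs \<noteq> cs"
      "?C bs \<inter> ?C cs \<noteq> {}"
    then have "\<forall>t\<le>n. digit_path x bs t = digit_path x cs t"
      by auto
    then show False
      using * path_eq_imp_eq[of bs cs x] by auto
  qed
  then have "\<P>(\<xi> in qmf_law p x. \<exists>bs. length bs = n \<and> Q bs \<and> (\<forall>t\<le>n. \<xi> t = digit_path x bs t)) =
      (\<Sum>bs | length bs = n \<and> Q bs. measure (qmf_law p x) (?C bs))"
    unfolding eq using sets
    by (intro finite_measure.finite_measure_finite_Union finite_measure_qmf_law finite_length_bool image_subsetI)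
  also have "\<dots> = (\<Sum>bs | length bs = n \<and> Q bs. path_weight p x bs)"
  proof (intro sum.cong refl)
    fix bs assume "bs \<in> {bs. length bs = n \<and> Q bs}"
    then have "n = length bs"
      by simp
    then show "measure (qmf_law p x) (?C bs) = path_weight p x bs"
      by (simp only: prob_path[OF assms])
  qed
  finally show "\<P>(\<xi> in qmf_law p x. \<exists>bs. length bs = n \<and> Q bs \<and> (\<forall>t\<le>n. \<xi> t = digit_path x bs t)) =
      (\<Sum>bs | length bs = n \<and> Q bs. path_weight p x bs)" .
qed

text \<open>For each length the lists of weight 0 contribute nothing to the total weight 1, so the
  paths of positive weight carry full probability; the countably many lengths are then
  combined.\<close>

lemma AE_path:
  assumes "QMF p"
  shows "AE \<xi> in qmf_law p x. \<forall>n. \<exists>bs. length bs = n \<and> path_weight p x bs > 0 \<and> (\<forall>t\<le>n. \<xi> t = digit_path x bs t)"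
proof -
  have sum: "(\<Sum>bs | length bs = n \<and> path_weight p x bs > 0. path_weight p x bs) = 1" for n
  proof -
    have "(\<Sum>bs | length bs = n \<and> path_weight p x bs > 0. path_weight p x bs) =
      (\<Sum>bs | length bs = n. path_weight p x bs)"
      using path_weight_nonneg[OF assms, of x] finite_length_bool[of n "\<lambda>_. True"]
      by (intro sum.mono_neutral_left) (auto simp: order.order_iff_strict)
    then show ?thesis
      by (simp add: sum_path_weight[OF assms])
  qed
  show ?thesis
    unfolding AE_all_countable
  proof
    fix n
    show "AE \<xi> in qmf_law p x. \<exists>bs. length bs = n \<and> path_weight p x bs > 0 \<and> (\<forall>t\<le>n. \<xi> t = digit_path x bs t)"
      using prob_paths(2)[OF assms, of x n "\<lambda>bs. path_weight p x bs > 0"] unfolding sum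
      by (rule iffD1[OF prob_space.prob_Collect_eq_1[OF prob_space_qmf_law prob_paths(1)[OF assms]]])
  qed
qed

text \<open>Almost every trajectory starts with some digit path, so an event decided by the times up
  to \<open>n\<close> agrees almost surely with a finite disjoint union of path cylinders.\<close>

lemma prob_eq_sum_path_weight:
  assumes "QMF p" "{\<xi> \<in> space (qmf_law p x). Q \<xi>} \<in> sets (qmf_law p x)"
    and Q: "\<And>\<xi> \<eta>. (\<And>t. t \<le> n \<Longrightarrow> \<xi> t = \<eta> t) \<Longrightarrow> Q \<xi> \<longleftrightarrow> Q \<eta>"
  shows "\<P>(\<xi> in qmf_law p x. Q \<xi>) = (\<Sum>bs | length bs = n \<and> Q (digit_path x bs). path_weight p x bs)"
proof -
  have "AE \<xi> in qmf_law p x. Q \<xi> \<longleftrightarrow>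
    (\<exists>bs. length bs = n \<and> Q (digit_path x bs) \<and> (\<forall>t\<le>n. \<xi> t = digit_path x bs t))"
    using AE_path[OF assms(1), of x]
  proof eventually_elim
    case (elim \<xi>)
    then obtain bs where bs: "length bs = n" "\<forall>t\<le>n. \<xi> t = digit_path x bs t"
      by blast
    show ?case
    proof
      assume "Q \<xi>"
      then have "Q (digit_path x bs)"
        using Q[of \<xi> "digit_path x bs"] bs by simp
      with bs show "\<exists>bs. length bs = n \<and> Q (digit_path x bs) \<and> (\<forall>t\<le>n. \<xi> t = digit_path x bs t)"
        by blast
    next
      assume "\<exists>bs. length bs = n \<and> Q (digit_path x bs) \<and> (\<forall>t\<le>n. \<xi> t = digit_path x bs t)"
      then obtain cs where "Q (digit_path x cs)" "\<forall>t\<le>n. \<xi> t = digit_path x cs t"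
        by blast
      then show "Q \<xi>"
        using Q[of \<xi> "digit_path x cs"] by simp
    qed
  qed
  then have "\<P>(\<xi> in qmf_law p x. Q \<xi>) = \<P>(\<xi> in qmf_law p x.
    \<exists>bs. length bs = n \<and> Q (digit_path x bs) \<and> (\<forall>t\<le>n. \<xi> t = digit_path x bs t))"
    by (intro finite_measure.finite_measure_eq_AE finite_measure_qmf_law assms(2) prob_paths(1)[OF assms(1)]) auto
  then show ?thesis
    by (simp only: prob_paths(2)[OF assms(1)])
qed

text \<open>Invariance only involves the first transition from points of \<open>B\<close>, hence
  only the weights at their two preimages under doubling.\<close>

lemma qmf_invariant_cong:
  assumes "QMF p" "QMF q" "qmf_invariant p B"
    and "\<And>x. x \<in> B \<Longrightarrow> q (x / 2) = p (x / 2) \<and> q (x / 2 + 1 / 2) = p (x / 2 + 1 / 2)"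
  shows "qmf_invariant q B"
proof -
  have eq: "\<P>(\<xi> in qmf_law r x. \<xi> 1 \<in> B) =
    (\<Sum>bs | length bs = 1 \<and> digit_path x bs 1 \<in> B. path_weight r x bs)" if "QMF r" for r x
    by (rule prob_eq_sum_path_weight[OF that sets_qmf_law_coord]) simp
  have "\<P>(\<xi> in qmf_law q x. \<xi> 1 \<in> B) = \<P>(\<xi> in qmf_law p x. \<xi> 1 \<in> B)" if "x \<in> B" for x
  proof -
    have "path_weight q x bs = path_weight p x bs" if "length bs = 1" for bs
    proof -
      from that obtain b where "bs = [b]"
        by (cases bs) auto
      then show ?thesis
        using assms(4)[OF \<open>x \<in> B\<close>] by (cases b) auto
    qed
    then show ?thesis
      unfolding eq[OF assms(1)] eq[OF assms(2)] by (intro sum.cong) auto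
  qed
  with assms(3) show ?thesis
    by (simp add: qmf_invariant_def)
qed

text \<open>The probability of staying in \<open>V\<close> up to time \<open>n\<close> (see
  \<open>prob_survival\<close>), written as a finite sum so that the first-step recursion is a mere
  rearrangement.\<close>

definition survival :: "(real \<Rightarrow> real) \<Rightarrow> real set \<Rightarrow> nat \<Rightarrow> real \<Rightarrow> real" where
  "survival p V n x = (\<Sum>bs | length bs = n \<and> (\<forall>t\<le>n. digit_path x bs t \<in> V). path_weight p x bs)"

lemma prob_survival:
  assumes "QMF p"
  shows "\<P>(\<xi> in qmf_law p x. \<forall>t\<le>n. \<xi> t \<in> V) = survival p V n x"
  unfolding survival_def
  by (rule prob_eq_sum_path_weight[OF assms sets_qmf_law_coords]) simp

lemma survival_nonneg: "QMF p \<Longrightarrow> survival p V n x \<ge> 0"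
  unfolding survival_def by (intro sum_nonneg path_weight_nonneg)

lemma survival_outside: "x \<notin> V \<Longrightarrow> survival p V n x = 0"
  by (auto simp: survival_def intro!: sum.neutral)

lemma survival_le_1: "QMF p \<Longrightarrow> survival p V n x \<le> 1"
  unfolding prob_survival[symmetric] by (rule prob_space.prob_le_1[OF prob_space_qmf_law])

lemma survival_Suc:
  assumes "x \<in> V"
  shows "survival p V (Suc n) x =
    p (x / 2) * survival p V n (x / 2) + p (x / 2 + 1 / 2) * survival p V n (x / 2 + 1 / 2)"
proof -
  have *: "(\<forall>t\<le>Suc n. digit_path x (b # bs) t \<in> V) \<longleftrightarrow> (\<forall>t\<le>n. digit_path (x / 2 + of_bool b / 2) bs t \<in> V)" for b bs
  proof
    assume *: "\<forall>t\<le>Suc n. digit_path x (b # bs) t \<in> V"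
    show "\<forall>t\<le>n. digit_path (x / 2 + of_bool b / 2) bs t \<in> V"
    proof (intro allI impI)
      fix t assume "t \<le> n"
      then show "digit_path (x / 2 + of_bool b / 2) bs t \<in> V"
        using *[rule_format, of "Suc t"] by simp
    qed
  next
    assume *: "\<forall>t\<le>n. digit_path (x / 2 + of_bool b / 2) bs t \<in> V"
    show "\<forall>t\<le>Suc n. digit_path x (b # bs) t \<in> V"
    proof (intro allI impI)
      fix t assume "t \<le> Suc n"
      then show "digit_path x (b # bs) t \<in> V"
        using assms *[rule_format, of "t - 1"] by (cases t) auto
    qed
  qed
  show ?thesis
    unfolding survival_def sum_length_Suc_bool *
    by (simp add: sum_distrib_left)
qed

section \<open>Decay of the survival probability\<close>

text \<open>Here \<open>min x (1 - x)\<close> is the distance to the nearest integer, and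
  \<open>d\<close> is at most halved by a step. During \<open>j\<close> steps \<open>d\<close>
  therefore stays at least \<open>\<delta>\<close>, and \<open>S\<close> bounds the survival over
  the remaining \<open>m\<close> steps. Taking a branch of weight at least \<open>e\<close> at each
  of the \<open>j\<close> steps halves the distance to the integers each time and ends outside
  \<open>{r..1-r}\<close>, which removes a share \<open>e ^ j\<close> from the bound. One induction
  yields both bounds, because the sharper one uses the weaker one on the other branch.\<close>

lemma survival_bound_step:
  fixes d :: "real \<Rightarrow> real"
  assumes p: "QMF p"
    and d: "\<And>x b. x \<in> {0..1} \<Longrightarrow> d x / 2 \<le> d (x / 2 + of_bool b / 2)"
    and e: "\<And>x. x \<in> {0..1} \<Longrightarrow> \<delta> \<le> d x \<Longrightarrow> \<exists>b. e \<le> p (x / 2 + of_bool b / 2) \<and>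
      min (x / 2 + of_bool b / 2) (1 - (x / 2 + of_bool b / 2)) = min x (1 - x) / 2"
    and "0 \<le> e" "0 \<le> \<delta>"
    and S: "\<And>y. y \<in> {0..1} \<Longrightarrow> \<delta> \<le> d y \<Longrightarrow> survival p {r..1-r} m y \<le> S"
    and "0 \<le> S"
    and x: "x \<in> {0..1}" "\<delta> * 2 ^ j \<le> d x"
  shows "survival p {r..1-r} (j + m) x \<le> S"
    and "min x (1 - x) / 2 ^ j < r \<Longrightarrow> survival p {r..1-r} (j + m) x \<le> (1 - e ^ j) * S"
proof -
  let ?s = "survival p {r..1-r}"
  have "?s (j + m) x \<le> S \<and> (min x (1 - x) / 2 ^ j < r \<longrightarrow> ?s (j + m) x \<le> (1 - e ^ j) * S)"
    using x
  proof (induction j arbitrary: x)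
    case 0
    then show ?case
      \<comment> \<open>With no step left, the premise of the sharper bound puts \<open>x\<close>
        outside the interval, which matches the factor \<open>1 - e ^ 0 = 0\<close>.\<close>
      using S by (auto intro!: survival_outside order.eq_iff[THEN iffD1, THEN conjunct1] split: if_splits simp: min_def)
  next
    case (Suc j)
    define y where "y b = x / 2 + of_bool b / 2" for b
    have y01: "y b \<in> {0..1}" for b
      using Suc.prems(1) by (cases b) (auto simp: y_def)
    have dy: "\<delta> * 2 ^ j \<le> d (y b)" for b
      using d[OF Suc.prems(1), of b] Suc.prems(2) by (simp add: y_def)
    note IH = Suc.IH[OF y01 dy]
    have "\<delta> * 1 \<le> \<delta> * 2 ^ Suc j"
      using \<open>0 \<le> \<delta>\<close> by (intro mult_left_mono one_le_power) auto
    then have "\<delta> \<le> d x"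
      using Suc.prems(2) by simp
    then obtain b where b: "e \<le> p (y b)" "min (y b) (1 - y b) = min x (1 - x) / 2"
      using e[OF Suc.prems(1)] unfolding y_def by blast
    have sum: "p (y b) + p (y (\<not> b)) = 1"
      using QMF_sum[OF p, of x] by (cases b) (auto simp: y_def)
    have pos: "0 \<le> p z" for z
      using p by (rule QMF_nonneg)
    show ?case
    proof (cases "x \<in> {r..1-r}")
      case False
      then have 0: "?s n x = 0" for n
        by (rule survival_outside)
      \<comment> \<open>The survival probabilities are 0 here, so it remains to see that
        \<open>1 - e ^ Suc j\<close> is nonnegative.\<close>
      have "e \<le> 1"
        using b(1) sum pos[of "y (\<not> b)"] by linarith
      then have "e ^ Suc j \<le> 1"
        using \<open>0 \<le> e\<close> by (rule power_le_one[rotated])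
      then show ?thesis
        using \<open>0 \<le> S\<close> by (simp add: 0)
    next
      case True
      then have eq: "?s (Suc j + m) x = p (y b) * ?s (j + m) (y b) + p (y (\<not> b)) * ?s (j + m) (y (\<not> b))"
        unfolding add_Suc by (subst survival_Suc) (cases b; simp add: y_def)+
      have 1: "p (y c) * ?s (j + m) (y c) \<le> p (y c) * S" for c
        using IH pos by (intro mult_left_mono) auto
      have "?s (Suc j + m) x \<le> p (y b) * S + p (y (\<not> b)) * S"
        unfolding eq by (intro add_mono 1)
      also have "\<dots> = S"
        unfolding distrib_right[symmetric] sum by simp
      finally have "?s (Suc j + m) x \<le> S" .
      moreover have "?s (Suc j + m) x \<le> (1 - e ^ Suc j) * S" if "min x (1 - x) / 2 ^ Suc j < r"
      proof -
        have "min (y b) (1 - y b) / 2 ^ j < r"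
          using that unfolding b(2) by (simp add: field_simps)
        then have "?s (j + m) (y b) \<le> (1 - e ^ j) * S"
          using IH[of b] by blast
        then have "p (y b) * ?s (j + m) (y b) \<le> p (y b) * ((1 - e ^ j) * S)"
          using pos by (rule mult_left_mono)
        then have "?s (Suc j + m) x \<le> p (y b) * ((1 - e ^ j) * S) + p (y (\<not> b)) * S"
          unfolding eq by (rule add_mono[OF _ 1])
        also have "\<dots> = (p (y b) + p (y (\<not> b))) * S - p (y b) * (e ^ j * S)"
          by (simp add: algebra_simps)
        also have "\<dots> \<le> S - e * (e ^ j * S)"
          unfolding sum using b(1) \<open>0 \<le> e\<close> \<open>0 \<le> S\<close> by (simp add: mult_right_mono)
        finally show ?thesis
          by (simp add: algebra_simps)
      qed
      ultimately show ?thesis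
        by blast
    qed
  qed
  then show "survival p {r..1-r} (j + m) x \<le> S"
    and "min x (1 - x) / 2 ^ j < r \<Longrightarrow> survival p {r..1-r} (j + m) x \<le> (1 - e ^ j) * S"
    by blast+
qed

text \<open>Time is cut into blocks of \<open>N\<close> steps, as \<open>N\<close> halvings bring
  any point of the unit interval within \<open>r\<close> of an integer. Throughout block
  \<open>i\<close> the value of \<open>d\<close> is at least
  \<open>\<delta> / 2 ^ (N * Suc i)\<close>, so each of its \<open>N\<close> favourable steps has
  weight at least \<open>h\<close> of that level.\<close>

lemma survival_bound:
  fixes d h :: "real \<Rightarrow> real"
  assumes p: "QMF p"
    and d: "\<And>x b. x \<in> {0..1} \<Longrightarrow> d x / 2 \<le> d (x / 2 + of_bool b / 2)"
    and h: "\<And>\<delta> x. 0 < \<delta> \<Longrightarrow> x \<in> {0..1} \<Longrightarrow> \<delta> \<le> d x \<Longrightarrow> \<exists>b. h \<delta> \<le> p (x / 2 + of_bool b / 2) \<and>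
      min (x / 2 + of_bool b / 2) (1 - (x / 2 + of_bool b / 2)) = min x (1 - x) / 2"
    and h01: "\<And>\<delta>. 0 < \<delta> \<Longrightarrow> 0 \<le> h \<delta>" "\<And>\<delta>. 0 < \<delta> \<Longrightarrow> h \<delta> \<le> 1"
    and N: "1 / 2 ^ N < r"
    and "0 < \<delta>" "x \<in> {0..1}" "\<delta> \<le> d x"
  shows "survival p {r..1-r} (k * N) x \<le> (\<Prod>i<k. 1 - h (\<delta> / 2 ^ (N * Suc i)) ^ N)"
  using assms(7-)
proof (induction k arbitrary: \<delta> x)
  case 0
  then show ?case
    by (simp add: survival_le_1[OF p])
next
  case (Suc k)
  \<comment> \<open>This level is kept by \<open>d\<close> throughout the first block and is the
    initial level for the remaining \<open>k\<close> blocks.\<close>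
  define \<epsilon> where "\<epsilon> = \<delta> / 2 ^ N"
  have "0 < \<epsilon>"
    using Suc.prems by (simp add: \<epsilon>_def)
  let ?S = "\<Prod>i<k. 1 - h (\<epsilon> / 2 ^ (N * Suc i)) ^ N"
  have "min x (1 - x) / 2 ^ N \<le> 1 / 2 ^ N"
    using Suc.prems by (intro divide_right_mono) auto
  also note N
  finally have less: "min x (1 - x) / 2 ^ N < r" .
  have "survival p {r..1-r} (N + k * N) x \<le> (1 - h \<epsilon> ^ N) * ?S"
  proof (rule survival_bound_step(2)[where d = d and \<delta> = \<epsilon>, OF p d _ _ _ _ _ _ _ less])
    show "\<exists>b. h \<epsilon> \<le> p (x / 2 + of_bool b / 2) \<and>
      min (x / 2 + of_bool b / 2) (1 - (x / 2 + of_bool b / 2)) = min x (1 - x) / 2"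
      if "x \<in> {0..1}" "\<epsilon> \<le> d x" for x
      using h[OF \<open>0 < \<epsilon>\<close> that] .
    show "survival p {r..1-r} (k * N) y \<le> ?S" if "y \<in> {0..1}" "\<epsilon> \<le> d y" for y
      using \<open>0 < \<epsilon>\<close> that by (rule Suc.IH)
    show "0 \<le> ?S"
      using \<open>0 < \<epsilon>\<close> by (intro prod_nonneg) (simp add: h01 power_le_one)
    show "\<epsilon> * 2 ^ N \<le> d x"
      using Suc.prems(3) by (simp add: \<epsilon>_def)
  qed (use Suc.prems \<open>0 < \<epsilon>\<close> in \<open>simp_all add: h01\<close>)
  also have "\<dots> = (\<Prod>i<Suc k. 1 - h (\<delta> / 2 ^ (N * Suc i)) ^ N)"
    unfolding prod.lessThan_Suc_shift by (simp add: \<epsilon>_def power_add[symmetric] algebra_simps)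
  finally show ?case
    by simp
qed

text \<open>Since \<open>1 - y \<le> exp (- y)\<close>, the product is at most the exponential of a
  negative multiple of a harmonic number.\<close>

lemma prod_one_minus_harmonic_tendsto_0:
  fixes a b C :: real
  assumes "0 < a" "0 < b" "0 < C"
    and f: "\<And>i. f i \<le> 1" "\<And>i. C / (a + b * real (Suc i)) \<le> f i"
  shows "(\<lambda>k. \<Prod>i<k. 1 - f i) \<longlonglongrightarrow> 0"
proof (rule tendsto_sandwich)
  \<comment> \<open>As \<open>Suc i\<close> is at least 1,
    \<open>a + b * Suc i \<le> (a + b) * Suc i\<close>; this constant turns the affine denominators
    into harmonic ones.\<close>
  define c where "c = C / (a + b)"
  have "0 < c"
    using assms by (simp add: c_def)
  have cf: "c / real (Suc i) \<le> f i" for i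
  proof -
    have "(a + b) * real (Suc i) \<ge> a + b * real (Suc i)"
      using assms by (simp add: algebra_simps)
    then have "C / ((a + b) * real (Suc i)) \<le> C / (a + b * real (Suc i))"
      using assms by (intro divide_left_mono mult_pos_pos add_pos_pos) auto
    with f(2)[of i] show ?thesis
      by (simp add: c_def)
  qed
  show "\<forall>\<^sub>F k in sequentially. 0 \<le> (\<Prod>i<k. 1 - f i)"
    using f by (intro always_eventually allI prod_nonneg) auto
  show "\<forall>\<^sub>F k in sequentially. (\<Prod>i<k. 1 - f i) \<le> exp (- (c * harm k))"
  proof (intro always_eventually allI)
    fix k
    have "(\<Prod>i<k. 1 - f i) \<le> (\<Prod>i<k. exp (- (c / real (Suc i))))"
    proof (intro prod_mono conjI)
      fix i
      have "1 - f i \<le> 1 + - (c / real (Suc i))"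
        using cf[of i] by simp
      also have "\<dots> \<le> exp (- (c / real (Suc i)))"
        by (rule exp_ge_add_one_self)
      finally show "1 - f i \<le> exp (- (c / real (Suc i)))" .
    qed (use f in auto)
    also have "\<dots> = exp (- (c * harm k))"
      unfolding exp_sum[OF finite_lessThan, symmetric]
      by (simp add: harm_altdef sum_distrib_left sum_negf divide_inverse)
    finally show "(\<Prod>i<k. 1 - f i) \<le> exp (- (c * harm k))" .
  qed
  have "LIM k sequentially. c * harm k :> at_top"
    using \<open>0 < c\<close> by (intro filterlim_tendsto_pos_mult_at_top[OF tendsto_const]) (use \<open>0 < c\<close> in \<open>auto simp: harm_at_top\<close>)
  then show "(\<lambda>k. exp (- (c * harm k))) \<longlonglongrightarrow> 0"
    by (intro filterlim_compose[OF exp_at_bot] filterlim_compose[OF filterlim_uminus_at_bot_at_top])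
qed simp

section \<open>From vanishing survival to convergence to 0 or 1\<close>

lemma AE_step:
  assumes "QMF p"
  shows "AE \<xi> in qmf_law p x. \<xi> 0 = x \<and>
    (\<forall>t. (\<exists>b. \<xi> (Suc t) = \<xi> t / 2 + of_bool b / 2) \<and> p (\<xi> (Suc t)) > 0)"
  using AE_path[OF assms, of x]
proof eventually_elim
  case (elim \<xi>)
  have "(\<exists>b. \<xi> (Suc t) = \<xi> t / 2 + of_bool b / 2) \<and> p (\<xi> (Suc t)) > 0" for t
  proof -
    from elim obtain bs where bs: "length bs = Suc t" "path_weight p x bs > 0"
      "\<forall>s\<le>Suc t. \<xi> s = digit_path x bs s"
      by blast
    then show ?thesis
      using path_step[of t bs x] path_weight_pos_step[OF assms bs(2), of t] by auto
  qed
  moreover have "\<xi> 0 = x"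
    using elim[rule_format, of 0] by auto
  ultimately show ?case
    by blast
qed

lemma sets_qmf_law_tendsto:
  "{\<xi> \<in> space (qmf_law p x). \<xi> \<longlonglongrightarrow> l} \<in> sets (qmf_law p x)"
proof -
  have "\<xi> \<longlonglongrightarrow> l \<longleftrightarrow> (\<forall>k. \<exists>n. \<forall>m. m \<ge> n \<longrightarrow> \<xi> m \<in> ball l (inverse (real (Suc k))))" for \<xi>
  proof
    assume "\<xi> \<longlonglongrightarrow> l"
    then show "\<forall>k. \<exists>n. \<forall>m. m \<ge> n \<longrightarrow> \<xi> m \<in> ball l (inverse (real (Suc k)))"
      by (auto simp: lim_sequentially dist_commute)
  next
    assume *: "\<forall>k. \<exists>n. \<forall>m. m \<ge> n \<longrightarrow> \<xi> m \<in> ball l (inverse (real (Suc k)))"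
    show "\<xi> \<longlonglongrightarrow> l"
    proof (rule metric_LIMSEQ_I)
      fix e :: real assume "e > 0"
      then obtain k where "inverse (real (Suc k)) < e"
        using reals_Archimedean by blast
      then show "\<exists>n. \<forall>m\<ge>n. dist (\<xi> m) l < e"
        using *[rule_format, of k] by (force simp: dist_commute)
    qed
  qed
  then show ?thesis
    by (simp only:) (intro sets.sets_Collect_countable_All sets.sets_Collect_countable_Ex
      sets.sets_Collect_imp sets_qmf_law_coord sets.sets_Collect_const)
qed

lemma halving_tendsto:
  fixes \<eta> :: "nat \<Rightarrow> real"
  assumes "\<And>s. \<eta> (T + s) = \<eta> T / 2 ^ s"
  shows "\<eta> \<longlonglongrightarrow> 0"
proof (rule LIMSEQ_offset[where k = T])
  have "(\<lambda>s. \<eta> T / 2 ^ s) \<longlonglongrightarrow> 0"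
    by (intro LIMSEQ_divide_realpow_zero) simp
  then show "(\<lambda>s. \<eta> (s + T)) \<longlonglongrightarrow> 0"
    by (simp add: assms add.commute[of _ T])
qed

text \<open>Vanishing survival forces almost every trajectory out of \<open>{r..1-r}\<close>. Once
  below \<open>r\<close> the state is halved forever; once above \<open>1 - r\<close> the distance
  to 1 is.\<close>

lemma prob_absorbed_eq_1:
  assumes p: "QMF p" and x: "x \<in> {0..1}"
    and near0: "\<And>y. 0 \<le> y \<Longrightarrow> y < r \<Longrightarrow> p (y / 2) = 1"
    and near1: "\<And>y. 1 - r < y \<Longrightarrow> y \<le> 1 \<Longrightarrow> p (y / 2 + 1 / 2) = 1"
    and surv: "(\<lambda>k. survival p {r..1-r} (a k) x) \<longlonglongrightarrow> 0"
  shows "\<P>(\<xi> in qmf_law p x. \<xi> \<longlonglongrightarrow> 0 \<or> \<xi> \<longlonglongrightarrow> 1) = 1"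
proof -
  let ?W = "{\<xi> \<in> space (qmf_law p x). \<forall>t. \<xi> t \<in> {r..1-r}}"
  have W: "?W \<in> sets (qmf_law p x)"
    by (intro sets.sets_Collect_countable_All sets_qmf_law_coord)
  have "measure (qmf_law p x) ?W \<le> survival p {r..1-r} (a k) x" for k
    unfolding prob_survival[OF p, symmetric]
    by (intro finite_measure.finite_measure_mono finite_measure_qmf_law sets_qmf_law_coords) blast
  then have "measure (qmf_law p x) ?W \<le> 0"
    by (intro tendsto_lowerbound[OF surv] always_eventually) auto
  then have "measure (qmf_law p x) ?W = 0"
    using measure_nonneg[of "qmf_law p x" ?W] by linarith
  then have "AE \<xi> in qmf_law p x. \<not> (\<forall>t. \<xi> t \<in> {r..1-r})"
    by (rule iffD1[OF prob_space.prob_Collect_eq_0[OF prob_space_qmf_law W]])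
  then have "AE \<xi> in qmf_law p x. \<xi> \<longlonglongrightarrow> 0 \<or> \<xi> \<longlonglongrightarrow> 1"
    using AE_step[OF p, of x]
  proof eventually_elim
    case (elim \<xi>)
    have step: "\<exists>b. \<xi> (Suc t) = \<xi> t / 2 + of_bool b / 2" "p (\<xi> (Suc t)) > 0" for t
      using elim(2) by blast+
    have unit: "\<xi> t \<in> {0..1}" for t
    proof (induction t)
      case 0
      then show ?case
        using elim(2) x by simp
    next
      case (Suc t)
      obtain b where "\<xi> (Suc t) = \<xi> t / 2 + of_bool b / 2"
        using step(1) by blast
      with Suc show ?case
        by (cases b) auto
    qed
    have down: "\<xi> (Suc t) = \<xi> t / 2" if "\<xi> t < r" for t
    proof -
      obtain b where b: "\<xi> (Suc t) = \<xi> t / 2 + of_bool b / 2"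
        using step(1) by blast
      \<comment> \<open>The two weights add up to 1, and almost surely no transition of weight 0
        occurs, so this branch is never taken.\<close>
      have "p (\<xi> t / 2 + 1 / 2) = 0"
        using near0[of "\<xi> t"] unit[of t] that QMF_sum[OF p, of "\<xi> t"] by simp
      then show ?thesis
        using step(2)[of t] b by (cases b) auto
    qed
    have up: "\<xi> (Suc t) = \<xi> t / 2 + 1 / 2" if "1 - r < \<xi> t" for t
    proof -
      obtain b where b: "\<xi> (Suc t) = \<xi> t / 2 + of_bool b / 2"
        using step(1) by blast
      have "p (\<xi> t / 2) = 0"
        using near1[of "\<xi> t"] unit[of t] that QMF_sum[OF p, of "\<xi> t"] by simp
      then show ?thesis
        using step(2)[of t] b by (cases b) auto
    qed
    obtain T where "\<xi> T \<notin> {r..1-r}"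
      using elim(1) by blast
    then consider "\<xi> T < r" | "1 - r < \<xi> T"
      by fastforce
    then show ?case
    proof cases
      case 1
      \<comment> \<open>The bound \<open>< r\<close> is carried along because it forces the next
        halving.\<close>
      have "\<xi> (T + s) = \<xi> T / 2 ^ s \<and> \<xi> (T + s) < r" for s
      proof (induction s)
        case (Suc s)
        then show ?case
          using down[of "T + s"] unit[of "T + s"] by simp
      qed (use 1 in simp)
      then have "\<xi> \<longlonglongrightarrow> 0"
        using halving_tendsto by blast
      then show ?thesis ..
    next
      case 2
      have "1 - \<xi> (T + s) = (1 - \<xi> T) / 2 ^ s \<and> 1 - r < \<xi> (T + s)" for s
      proof (induction s)
        case (Suc s)
        then show ?case
          using up[of "T + s"] unit[of "T + s"] by (simp add: diff_divide_distrib)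
      qed (use 2 in simp)
      then have "(\<lambda>t. 1 - \<xi> t) \<longlonglongrightarrow> 0"
        using halving_tendsto[of "\<lambda>t. 1 - \<xi> t"] by blast
      then have "(\<lambda>t. 1 - (1 - \<xi> t)) \<longlonglongrightarrow> 1 - 0"
        by (intro tendsto_diff tendsto_const)
      then show ?thesis
        by simp
    qed
  qed
  moreover have "{\<xi> \<in> space (qmf_law p x). \<xi> \<longlonglongrightarrow> 0 \<or> \<xi> \<longlonglongrightarrow> 1} \<in> sets (qmf_law p x)"
    by (intro sets.sets_Collect_disj sets_qmf_law_tendsto)
  ultimately show ?thesis
    by (intro iffD2[OF prob_space.prob_Collect_eq_1[OF prob_space_qmf_law]])
qed

section \<open>Sets invariant under doubling\<close>

lemma frac_mult_frac: "frac (of_nat n * frac x) = frac (of_nat n * x :: real)"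
proof -
  have "of_nat n * x - of_nat n * frac x = of_int (int n * \<lfloor>x\<rfloor>)"
    by (simp add: frac_def algebra_simps)
  then have "of_nat n * x = of_nat n * frac x + of_int (int n * \<lfloor>x\<rfloor>)"
    by linarith
  then show ?thesis
    by (simp only: frac_add_of_int_right)
qed

lemma frac_power2_mult:
  fixes x :: real
  assumes "\<And>x. x \<in> B \<Longrightarrow> frac (2 * x) \<in> B" "x \<in> B" "B \<subseteq> {0<..<1}"
  shows "frac (2 ^ n * x) \<in> B"
proof (induction n)
  case 0
  have "frac x = x"
    using assms(2,3) by (intro frac_eq[THEN iffD2]) auto
  then show ?case
    using assms(2) by simp
next
  case (Suc n)
  then have "frac (2 * frac (2 ^ n * x)) \<in> B"
    by (rule assms(1))
  then show ?case
    using frac_mult_frac[of 2 "2 ^ n * x"] by (simp add: mult.assoc)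
qed

text \<open>Each dyadic interval of length \<open>1 / M\<close> carries at most \<open>1 / M\<close> of the measure of \<open>B\<close>, and the
  first of them carries none.\<close>

lemma doubling_invariant_null:
  fixes B :: "real set"
  assumes "B \<subseteq> {0<..<1}" "closed B" "\<And>x. x \<in> B \<Longrightarrow> frac (2 * x) \<in> B"
  shows "B \<in> null_sets lborel"
proof -
  have "compact B"
    using compact_Int_closed[OF compact_Icc[of 0 1] assms(2)] assms(1)
    by (metis inf.absorb2 order.trans greaterThanLessThan_subseteq_atLeastAtMost_iff order_refl)
  then have lm: "B \<in> lmeasurable"
    by (rule lmeasurable_compact)
  have "open (- B)" "0 \<in> - B"
    using assms by auto
  then obtain r where "r > 0" "ball 0 r \<subseteq> - B"
    by (rule openE)
  then have r: "r > 0" "\<And>y. \<bar>y\<bar> < r \<Longrightarrow> y \<notin> B"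
    by (auto simp: ball_def dist_real_def)
  obtain N where N: "(1 / 2) ^ N < r"
    using real_arch_pow_inv[OF \<open>r > 0\<close>, of "1 / 2"] by auto
  define M :: nat where "M = 2 ^ N"
  have M: "real M > 0" "real M = 2 ^ N" "1 / real M < r"
    using N by (auto simp: M_def power_divide)
  let ?I = "\<lambda>k::nat. (\<lambda>y. (1 / real M) *\<^sub>R y + real k / real M) ` B"
  have sub: "B \<subseteq> (\<Union>k\<in>{1..<M}. ?I k)"
  proof
    fix x assume x: "x \<in> B"
    then have x01: "0 < x" "x < 1"
      using assms(1) by auto
    define k where "k = nat \<lfloor>real M * x\<rfloor>"
    have k: "real k \<le> real M * x" "real M * x < real k + 1"
      using x01 M(1) by (simp_all add: k_def)
    have "real M * x < real M"
      using x01 M(1) by simp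
    with k have "k < M"
      by linarith
    moreover have "k \<noteq> 0"
    proof
      assume "k = 0"
      then have "x < 1 / real M"
        using k M(1) by (simp add: field_simps)
      then show False
        using r(2)[of x] x x01 M(3) by auto
    qed
    moreover have "x \<in> ?I k"
    proof
      \<comment> \<open>\<open>M\<close> is a power of 2, so multiplication by \<open>M\<close>
        modulo 1 maps \<open>B\<close> into itself; \<open>x\<close> is the image point rescaled
        into the \<open>k\<close>-th dyadic interval.\<close>
      show "frac (real M * x) \<in> B"
        using frac_power2_mult[OF assms(3) x assms(1)] by (simp add: M)
      have "frac (real M * x) = real M * x - real k"
        using x01 M(1) by (simp add: frac_def k_def)
      then show "x = (1 / real M) *\<^sub>R frac (real M * x) + real k / real M"
        using M(1) by (simp add: field_simps)
    qed
    ultimately show "x \<in> (\<Union>k\<in>{1..<M}. ?I k)"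
      by auto
  qed
  have Ilm: "?I k \<in> lmeasurable" for k
    by (intro lmeasurable_compact compact_continuous_image continuous_intros \<open>compact B\<close>)
  \<comment> \<open>\<open>M - 1\<close> copies of \<open>B\<close> scaled by \<open>1 / M\<close>
    cover \<open>B\<close>, so its finite measure is at most a proper fraction of itself and hence
    0.\<close>
  have "measure lebesgue B \<le> measure lebesgue (\<Union>k\<in>{1..<M}. ?I k)"
    using sub lm Ilm by (intro measure_mono_fmeasurable fmeasurable.finite_UN) auto
  also have "\<dots> \<le> (\<Sum>k\<in>{1..<M}. measure lebesgue (?I k))"
    using Ilm by (intro measure_UNION_le) auto
  also have "\<dots> = (real M - 1) / real M * measure lebesgue B"
    using M(1) by (simp only: measure_lebesgue_affine) (simp add: of_nat_diff)
  finally have "measure lebesgue B * (1 - (real M - 1) / real M) \<le> 0"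
    by (simp add: algebra_simps)
  moreover have "1 - (real M - 1) / real M > 0"
    using M(1) by (simp add: field_simps)
  ultimately have "measure lebesgue B = 0"
    using measure_nonneg[of lebesgue B] by (simp add: mult_le_0_iff)
  then have "emeasure lebesgue B = 0"
    using lm by (simp add: emeasure_eq_measure2)
  then show ?thesis
    using assms(2) by (auto simp: null_sets_def)
qed

text \<open>The \<open>N\<close>-th power decays so slowly that it is not summable along \<open>d = c / 2 ^ k\<close>.\<close>

lemma log_modulus_exists:
  fixes c :: real
  assumes "0 < c" "0 < N"
  obtains H :: "real \<Rightarrow> real" where "continuous_on UNIV H" "mono H" "\<And>d. 0 \<le> H d" "\<And>d. H d \<le> 1"
    "H 0 = 0" "\<And>d. c \<le> d \<Longrightarrow> H d = 1"
    "\<And>d. 0 < d \<Longrightarrow> d \<le> c \<Longrightarrow> H d ^ N = 1 / (1 + ln (c / d))"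
proof -
  \<comment> \<open>\<open>L\<close> is the \<open>N\<close>-th power of the function sought. The
    minimum caps it at 1 from \<open>c\<close> onwards, and the case split prescribes 0 where the
    logarithm has no meaning.\<close>
  define L where "L d = (if d \<le> 0 then 0 else 1 / (1 - ln (min 1 (d / c))))" for d
  have pos: "1 - ln (min 1 (d / c)) \<ge> 1" if "0 < d" for d
    using that assms by simp
  have L01: "0 \<le> L d" "L d \<le> 1" for d
    using pos[of d] by (auto simp: L_def)
  have mono: "L d \<le> L d'" if "d \<le> d'" for d d'
  proof (cases "d \<le> 0")
    case False
    then have "ln (min 1 (d / c)) \<le> ln (min 1 (d' / c))"
      using that assms by (intro ln_mono) (auto simp: min_le_iff_disj divide_right_mono)
    then show ?thesis
      using False that pos[of d] pos[of d'] by (auto simp: L_def intro!: divide_left_mono)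
  qed (use L01 in \<open>auto simp: L_def\<close>)
  have "isCont L d" for d
  proof (rule linorder_cases[of d 0])
    assume "d < 0"
    then have "\<forall>\<^sub>F y in nhds d. L y = 0"
      using eventually_nhds_in_open[of "{..<0}" d] by (auto simp: L_def elim!: eventually_mono)
    then show ?thesis
      by (subst isCont_cong) auto
  next
    assume "0 < d"
    then have "\<forall>\<^sub>F y in nhds d. L y = 1 / (1 - ln (min 1 (y / c)))"
      using eventually_nhds_in_open[of "{0<..}" d] by (auto simp: L_def elim!: eventually_mono)
    moreover have "isCont (\<lambda>y. 1 / (1 - ln (min 1 (y / c)))) d"
    proof -
      have "min 1 (d / c) \<noteq> 0"
        using \<open>0 < d\<close> \<open>0 < c\<close> by (auto simp: min_def)
      moreover have "1 - ln (min 1 (d / c)) \<noteq> 0"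
        using pos[OF \<open>0 < d\<close>] by linarith
      ultimately show ?thesis
        using \<open>0 < c\<close> by (intro continuous_intros) auto
    qed
    ultimately show ?thesis
      by (subst isCont_cong) auto
  next
    \<comment> \<open>Only the limit from the right has content: \<open>- ln (y / c)\<close> tends
      to infinity there, so the reciprocal tends to 0.\<close>
    assume [simp]: "d = 0"
    have "(L \<longlongrightarrow> 0) (at_left 0)"
      by (rule tendsto_eventually) (auto simp: L_def eventually_at_filter)
    moreover have "(L \<longlongrightarrow> 0) (at_right 0)"
    proof (rule tendsto_cong[THEN iffD1])
      have "LIM y at_right 0. y / c :> at_right 0"
        unfolding filterlim_at
      proof
        show "\<forall>\<^sub>F y in at_right 0. y / c \<in> {0<..} \<and> y / c \<noteq> 0"
          using eventually_at_right_less[of 0] by eventually_elim (use \<open>0 < c\<close> in auto)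
        show "((\<lambda>y. y / c) \<longlongrightarrow> 0) (at_right 0)"
          by (rule tendsto_divide_zero) (rule tendsto_ident_at)
      qed
      then have "LIM y at_right 0. ln (y / c) :> at_bot"
        by (rule filterlim_compose[OF ln_at_0])
      then have "LIM y at_right 0. - ln (y / c) :> at_top"
        by (rule filterlim_compose[OF filterlim_uminus_at_top_at_bot])
      then have "LIM y at_right 0. 1 + - ln (y / c) :> at_top"
        by (rule filterlim_tendsto_add_at_top[OF tendsto_const])
      then show "((\<lambda>y. inverse (1 + - ln (y / c))) \<longlongrightarrow> 0) (at_right 0)"
        by (rule tendsto_inverse_0_at_top)
      show "\<forall>\<^sub>F y in at_right 0. inverse (1 + - ln (y / c)) = L y"
        using eventually_at_right_less[of 0] eventually_at_right_real[OF \<open>0 < c\<close>]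
        by eventually_elim (use \<open>0 < c\<close> in \<open>auto simp: L_def min_def field_simps\<close>)
    qed
    ultimately show ?thesis
      by (simp add: isCont_def filterlim_split_at L_def)
  qed
  then have cont: "continuous_on UNIV L"
    by (simp add: continuous_on_eq_continuous_at)
  show thesis
  proof
    show "continuous_on UNIV (\<lambda>d. root N (L d))"
      by (intro continuous_intros cont)
    show "mono (\<lambda>d. root N (L d))"
      using mono assms by (auto intro!: monoI real_root_le_mono)
    show "0 \<le> root N (L d)" "root N (L d) \<le> 1" for d
      using L01[of d] assms by auto
    show "root N (L 0) = 0"
      by (simp add: L_def)
    show "root N (L d) = 1" if "c \<le> d" for d
      using that assms by (auto simp: L_def min_def field_simps)
    show "root N (L d) ^ N = 1 / (1 + ln (c / d))" if "0 < d" "d \<le> c" for d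
    proof -
      have "root N (L d) ^ N = L d"
        using assms L01 by simp
      also have "\<dots> = 1 / (1 + ln (c / d))"
        using that assms by (simp add: L_def min_def ln_div)
      finally show ?thesis .
    qed
  qed
qed

text \<open>On the unit circle doubling modulo 1 becomes squaring, and |z^2 - w^2| = |z - w| |z + w|
  is at most 2 |z - w|. So the chordal distance to the image of \<open>B\<close> at most
  doubles.\<close>

lemma circle_distance_exists:
  fixes B :: "real set"
  assumes "closed B" "B \<subseteq> {0<..<1}" "B \<noteq> {}" and inv: "\<And>x. x \<in> B \<Longrightarrow> frac (2 * x) \<in> B"
  obtains d :: "real \<Rightarrow> real" where "continuous_on UNIV d" "\<And>x. d (x + 1) = d x" "\<And>x. d (2 * x) \<le> 2 * d x"
    "\<And>x. x \<in> B \<Longrightarrow> d x = 0" "\<And>x. x \<in> {0..1} - B \<Longrightarrow> 0 < d x"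
proof -
  define e where "e x = cis (2 * pi * x)" for x
  have e_int: "e (x + of_int k) = e x" for x k
  proof -
    have "e (x + of_int k) = e x * cis (2 * pi * of_int k)"
      unfolding e_def cis_mult by (rule arg_cong[where f = cis]) (simp add: distrib_left)
    also have "cis (2 * pi * of_int k) = 1"
      by (rule cis_multiple_2pi) simp
    finally show ?thesis
      by simp
  qed
  have e_double: "e (2 * x) = e x * e x" for x
    by (simp add: e_def cis_mult)
  have e_cont: "continuous_on UNIV e"
    unfolding e_def by (intro continuous_intros)
  have "compact B"
    using compact_Int_closed[OF compact_Icc[of 0 1] assms(1)] assms(2)
    by (metis inf.absorb2 order.trans greaterThanLessThan_subseteq_atLeastAtMost_iff order_refl)
  then have "compact (e ` B)"
    using e_cont continuous_on_subset by (intro compact_continuous_image) blast+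
  then have closed: "closed (e ` B)"
    by (rule compact_imp_closed)
  have ne: "e ` B \<noteq> {}"
    using assms(3) by simp
  have double: "z * z \<in> e ` B" if "z \<in> e ` B" for z
  proof -
    from that obtain b where "b \<in> B" "z = e b"
      by blast
    moreover have "e (2 * b) = e (frac (2 * b))"
      using e_int[of "frac (2 * b)" "\<lfloor>2 * b\<rfloor>"] by (simp add: frac_def)
    ultimately show ?thesis
      using inv by (simp add: e_double[symmetric])
  qed
  show thesis
  proof
    show "continuous_on UNIV (\<lambda>x. infdist (e x) (e ` B))"
      by (intro continuous_on_infdist e_cont)
    show "infdist (e (x + 1)) (e ` B) = infdist (e x) (e ` B)" for x
      using e_int[of x 1] by simp
    show "infdist (e (2 * x)) (e ` B) \<le> 2 * infdist (e x) (e ` B)" for x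
    proof -
      \<comment> \<open>The image is closed, so a nearest point exists, and its square lies in the
        image again.\<close>
      obtain w where w: "w \<in> e ` B" "infdist (e x) (e ` B) = dist (e x) w"
        using infdist_attains_inf[OF closed ne] by blast
      have "infdist (e (2 * x)) (e ` B) \<le> dist (e x * e x) (w * w)"
        unfolding e_double using double[OF w(1)] by (rule infdist_le)
      also have "\<dots> = dist (e x) w * norm (e x + w)"
        unfolding dist_norm norm_mult[symmetric] by (simp add: algebra_simps)
      also have "\<dots> \<le> dist (e x) w * 2"
        using w(1) by (intro mult_left_mono norm_triangle_le) (auto simp: e_def)
      finally show ?thesis
        unfolding w(2) by (simp only: mult.commute)
    qed
    show "infdist (e x) (e ` B) = 0" if "x \<in> B" for x
      using that by simp
    show "0 < infdist (e x) (e ` B)" if "x \<in> {0..1} - B" for x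
    proof (rule infdist_pos_not_in_closed[OF closed ne])
      show "e x \<notin> e ` B"
      proof
        assume "e x \<in> e ` B"
        then obtain b where b: "b \<in> B" "e x = e b"
          by blast
        then obtain n :: int where
          "\<i> * of_real (2 * pi * x) = \<i> * of_real (2 * pi * b) + of_int (2 * n) * pi * \<i>"
          unfolding e_def cis_conv_exp exp_eq by blast
        from arg_cong[OF this, of Im] have "2 * pi * x = 2 * pi * b + 2 * pi * of_int n"
          by simp
        then have "x = b + of_int n"
          by (simp add: distrib_left[symmetric])
        \<comment> \<open>\<open>x\<close> may be an endpoint of the unit interval; that
          \<open>b\<close> lies strictly inside excludes every integer difference except 0.\<close>
        moreover have "0 < b" "b < 1"
          using b assms(2) by auto
        ultimately have "n = 0"
          using that by auto
        then show False
          using \<open>x = b + of_int n\<close> b that by simp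
      qed
    qed
  qed
qed

section \<open>Construction of the absorbing QMF function\<close>

text \<open>The offset 1/2 makes the unclipped values at \<open>y\<close> and
  \<open>y + 1 / 2\<close> add up to 1, and clipping to the unit interval preserves this, being
  symmetric under t -> 1 - t. Clipping creates the plateau of value 1 that makes the motion near the
  integers deterministic.\<close>

definition clipped_cos :: "real \<Rightarrow> real" where
  "clipped_cos y = max 0 (min 1 (1 / 2 + cos (2 * pi * y)))"

lemma clipped_cos_half: "clipped_cos y + clipped_cos (y + 1 / 2) = 1"
proof -
  have "cos (2 * pi * (y + 1 / 2)) = - cos (2 * pi * y)"
    by (simp add: distrib_left cos_add)
  then show ?thesis
    by (simp add: clipped_cos_def max_def min_def)
qed

lemma QMF_clipped_cos: "QMF clipped_cos"
  unfolding QMF_def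
proof (intro conjI ballI allI)
  show "continuous_on UNIV clipped_cos"
    unfolding clipped_cos_def by (intro continuous_intros)
  show "clipped_cos (\<xi> + 1) = clipped_cos \<xi>" for \<xi>
    by (simp add: clipped_cos_def distrib_left cos_add)
  show "clipped_cos (\<xi> / 2) + clipped_cos (\<xi> / 2 + 1 / 2) = 1" for \<xi>
    by (rule clipped_cos_half)
qed (auto simp: clipped_cos_def)

lemma clipped_cos_shift: "clipped_cos (y + 1 / 2) = clipped_cos (y - 1 / 2)"
proof -
  have "y + 1 / 2 = (y - 1 / 2) + 1"
    by simp
  then show ?thesis
    by (simp only: QMF_periodic[OF QMF_clipped_cos])
qed

lemma cos_2pi_ge_half:
  assumes "\<bar>y\<bar> \<le> 1 / 6"
  shows "1 / 2 \<le> cos (2 * pi * y)"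
proof -
  have "2 * pi * \<bar>y\<bar> \<le> 2 * pi * (1 / 6)"
    using assms by (intro mult_left_mono) auto
  then have "cos (pi / 3) \<le> cos (2 * pi * \<bar>y\<bar>)"
    by (intro cos_monotone_0_pi_le) auto
  also have "cos (2 * pi * \<bar>y\<bar>) = cos (2 * pi * y)"
    by (simp add: abs_if)
  finally show ?thesis
    by (simp add: cos_60)
qed

lemma cos_2pi_nonneg:
  assumes "\<bar>y\<bar> \<le> 1 / 4"
  shows "0 \<le> cos (2 * pi * y)"
proof -
  have "2 * pi * \<bar>y\<bar> \<le> 2 * pi * (1 / 4)"
    using assms by (intro mult_left_mono) auto
  then have "\<bar>2 * pi * y\<bar> \<le> pi / 2"
    by (simp add: abs_mult)
  then have "- (pi / 2) \<le> 2 * pi * y" "2 * pi * y \<le> pi / 2"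
    by linarith+
  then show ?thesis
    by (rule cos_ge_zero)
qed

lemma clipped_cos_eq_1: "\<bar>y\<bar> \<le> 1 / 6 \<Longrightarrow> clipped_cos y = 1"
  using cos_2pi_ge_half[of y] by (simp add: clipped_cos_def)

lemma clipped_cos_ge_half: "\<bar>y\<bar> \<le> 1 / 4 \<Longrightarrow> 1 / 2 \<le> clipped_cos y"
  using cos_2pi_nonneg[of y] by (simp add: clipped_cos_def)

text \<open>\<open>2 * y\<close> and \<open>2 * (y + 1 / 2)\<close> agree modulo 1, so both
  successors of a state are blended with the same weight and their sum stays 1.\<close>

lemma QMF_blend:
  assumes p: "QMF p" and q: "QMF q"
    and g: "continuous_on UNIV g" "\<And>x. g (x + 1) = g x" "\<And>x. 0 \<le> g x" "\<And>x. g x \<le> 1"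
  shows "QMF (\<lambda>y. (1 - g (2 * y)) * p y + g (2 * y) * q y)"
  unfolding QMF_def
proof (intro conjI ballI allI)
  show "0 \<le> (1 - g (2 * y)) * p y + g (2 * y) * q y" for y
    using g p q by (simp add: QMF_nonneg)
  have cont: "continuous_on UNIV p" "continuous_on UNIV q"
    using p q by (auto simp: QMF_def)
  have "continuous_on UNIV (\<lambda>y. g (2 * y))"
    by (intro continuous_on_compose2[OF g(1)] continuous_intros) auto
  then show "continuous_on UNIV (\<lambda>y. (1 - g (2 * y)) * p y + g (2 * y) * q y)"
    by (intro continuous_intros cont)
  show "(1 - g (2 * (y + 1))) * p (y + 1) + g (2 * (y + 1)) * q (y + 1) =
    (1 - g (2 * y)) * p y + g (2 * y) * q y" for y
  proof -
    have "g (2 * (y + 1)) = g (2 * y)"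
      using g(2)[of "2 * y"] g(2)[of "2 * y + 1"] by (simp add: algebra_simps)
    then show ?thesis
      by (simp only: QMF_periodic[OF p] QMF_periodic[OF q])
  qed
  show "(1 - g (2 * (y / 2))) * p (y / 2) + g (2 * (y / 2)) * q (y / 2) +
    ((1 - g (2 * (y / 2 + 1 / 2))) * p (y / 2 + 1 / 2) + g (2 * (y / 2 + 1 / 2)) * q (y / 2 + 1 / 2)) = 1" for y
  proof -
    have "g (2 * (y / 2 + 1 / 2)) = g y"
      using g(2)[of y] by (simp add: distrib_left)
    then have "?thesis \<longleftrightarrow> (1 - g y) * (p (y / 2) + p (y / 2 + 1 / 2)) +
      g y * (q (y / 2) + q (y / 2 + 1 / 2)) = 1"
      by (simp add: algebra_simps)
    then show ?thesis
      unfolding QMF_sum[OF p] QMF_sum[OF q] by simp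
  qed
  have "p 0 = 1" "q 0 = 1"
    using p q by (auto simp: QMF_def)
  then show "(1 - g (2 * 0)) * p 0 + g (2 * 0) * q 0 = 1"
    by simp
qed

lemma QMF_absorbing_modification:
  fixes B :: "real set"
  assumes p: "QMF p" and B: "closed B" "B \<subseteq> {0<..<1}" "B \<noteq> {}" "\<And>x. x \<in> B \<Longrightarrow> frac (2 * x) \<in> B"
  obtains p' where "QMF p'"
    "\<And>x. x \<in> B \<Longrightarrow> p' (x / 2) = p (x / 2) \<and> p' (x / 2 + 1 / 2) = p (x / 2 + 1 / 2)"
    "\<And>x. x \<in> {0..1} - B \<Longrightarrow> \<P>(\<xi> in qmf_law p' x. \<xi> \<longlonglongrightarrow> 0 \<or> \<xi> \<longlonglongrightarrow> 1) = 1"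
proof -
  obtain d :: "real \<Rightarrow> real" where d: "continuous_on UNIV d" "\<And>x. d (x + 1) = d x"
    "\<And>x. d (2 * x) \<le> 2 * d x" "\<And>x. x \<in> B \<Longrightarrow> d x = 0" "\<And>x. x \<in> {0..1} - B \<Longrightarrow> 0 < d x"
    using circle_distance_exists[OF B] by blast
  \<comment> \<open>Any value strictly between 0 and \<open>d 0\<close> would do: then
    \<open>d\<close> exceeds \<open>c\<close>, and the blending weight is 1, near the
    integers.\<close>
  define c where "c = d 0 / 2"
  have "0 < d 0"
    using B(2) by (intro d(5)) auto
  then have c: "0 < c" "c < d 0"
    by (auto simp: c_def)
  have "open (d -` {c<..})"
    using d(1) by (intro open_vimage) auto
  moreover have "0 \<in> d -` {c<..}"
    using c by simp
  ultimately obtain r0 where r0: "0 < r0" "ball 0 r0 \<subseteq> d -` {c<..}"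
    by (rule openE)
  \<comment> \<open>For \<open>y\<close> within 1/3 of 0, \<open>y / 2\<close> is within 1/6 of 0
    and hence on the plateau of the clipped cosine.\<close>
  define r where "r = min r0 (1 / 3)"
  have r: "0 < r" "r \<le> 1 / 3"
    using r0 by (auto simp: r_def)
  have d_near: "c \<le> d x" if "\<bar>x\<bar> < r" for x
  proof -
    have "x \<in> ball 0 r0"
      using that by (simp add: r_def dist_real_def)
    with r0 show ?thesis
      by (auto dest: subsetD)
  qed
  \<comment> \<open>\<open>N\<close> steps towards the nearest integer end at distance less than
    \<open>r\<close>. This number is fixed before \<open>H\<close> because the product of
    \<open>N\<close> factors \<open>H\<close> is to be of harmonic order.\<close>
  obtain N where N: "(1 / 2) ^ N < r"
    using real_arch_pow_inv[OF \<open>0 < r\<close>, of "1 / 2"] by auto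
  have "0 < N"
    using N r by (cases N) auto
  obtain H :: "real \<Rightarrow> real" where H: "continuous_on UNIV H" "mono H" "\<And>d. 0 \<le> H d" "\<And>d. H d \<le> 1"
    "H 0 = 0" "\<And>d. c \<le> d \<Longrightarrow> H d = 1"
    "\<And>d. 0 < d \<Longrightarrow> d \<le> c \<Longrightarrow> H d ^ N = 1 / (1 + ln (c / d))"
    using log_modulus_exists[OF \<open>0 < c\<close> \<open>0 < N\<close>] by blast
  \<comment> \<open>\<open>2 * y\<close> is congruent to the state from which the process moves to \<open>y\<close>.\<close>
  define p' where "p' y = (1 - H (d (2 * y))) * p y + H (d (2 * y)) * clipped_cos y" for y
  have p'_half: "p' (x / 2 + of_bool b / 2) = (1 - H (d x)) * p (x / 2 + of_bool b / 2) +
    H (d x) * clipped_cos (x / 2 + of_bool b / 2)" for x b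
    using d(2)[of x] by (cases b) (simp_all add: p'_def distrib_left)
  have "QMF p'"
    unfolding p'_def
    by (intro QMF_blend p QMF_clipped_cos continuous_on_compose2[OF H(1) d(1)]) (auto simp: d(2) H(3,4))
  moreover have "p' (x / 2) = p (x / 2) \<and> p' (x / 2 + 1 / 2) = p (x / 2 + 1 / 2)" if "x \<in> B" for x
    using p'_half[of x False] p'_half[of x True] d(4)[OF that] H(5) by simp
  moreover have "\<P>(\<xi> in qmf_law p' x. \<xi> \<longlonglongrightarrow> 0 \<or> \<xi> \<longlonglongrightarrow> 1) = 1" if x: "x \<in> {0..1} - B" for x
  proof (rule prob_absorbed_eq_1[OF \<open>QMF p'\<close>])
    show "x \<in> {0..1}"
      using x by simp
    show "p' (y / 2) = 1" if "0 \<le> y" "y < r" for y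
      using p'_half[of y False] d_near[of y] that r H(6) by (simp add: clipped_cos_eq_1)
    show "p' (y / 2 + 1 / 2) = 1" if "1 - r < y" "y \<le> 1" for y
    proof -
      have "d y = d (y - 1)"
        using d(2)[of "y - 1"] by simp
      then have "H (d y) = 1"
        using d_near[of "y - 1"] that by (intro H(6)) auto
      moreover have "clipped_cos (y / 2 + 1 / 2) = clipped_cos (y / 2 - 1 / 2)"
        by (rule clipped_cos_shift)
      moreover have "clipped_cos (y / 2 - 1 / 2) = 1"
        using that r by (intro clipped_cos_eq_1) auto
      ultimately show ?thesis
        using p'_half[of y True] by simp
    qed
    \<comment> \<open>At most \<open>d x\<close>, to start the survival bound; at most
      \<open>c\<close>, so that the logarithmic formula for \<open>H\<close> applies at all later
      levels.\<close>
    define \<delta> where "\<delta> = min c (d x)"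
    have \<delta>: "0 < \<delta>" "\<delta> \<le> c" "\<delta> \<le> d x"
      using c d(5)[OF x] by (auto simp: \<delta>_def)
    define f where "f i = (H (\<delta> / 2 ^ (N * Suc i)) / 2) ^ N" for i
    have le: "survival p' {r..1-r} (k * N) x \<le> (\<Prod>i<k. 1 - f i)" for k
      unfolding f_def
    proof (rule survival_bound[where d = d and h = "\<lambda>\<delta>. H \<delta> / 2", OF \<open>QMF p'\<close>])
      show "d x / 2 \<le> d (x / 2 + of_bool b / 2)" for x b
        using d(3)[of "x / 2 + of_bool b / 2"] d(2)[of x] by (cases b) (simp_all add: distrib_left)
      show "\<exists>b. H \<epsilon> / 2 \<le> p' (y / 2 + of_bool b / 2) \<and>
        min (y / 2 + of_bool b / 2) (1 - (y / 2 + of_bool b / 2)) = min y (1 - y) / 2"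
        if y: "y \<in> {0..1}" and \<epsilon>: "\<epsilon> \<le> d y" for \<epsilon> y
      proof (intro exI conjI)
        \<comment> \<open>This branch leads towards the nearest integer, so \<open>?z\<close> lies
          within 1/4 of an integer, where the clipped cosine is at least 1/2.\<close>
        let ?b = "y > 1 / 2"
        let ?z = "y / 2 + of_bool ?b / 2"
        have "1 / 2 \<le> clipped_cos ?z"
        proof (cases ?b)
          case False
          then show ?thesis
            using y by (intro clipped_cos_ge_half) auto
        next
          case True
          have "1 / 2 \<le> clipped_cos (y / 2 - 1 / 2)"
            using True y by (intro clipped_cos_ge_half) auto
          also have "\<dots> = clipped_cos ?z"
            using clipped_cos_shift[of "y / 2"] True by simp
          finally show ?thesis .
        qed
        then have "H (d y) * (1 / 2) \<le> H (d y) * clipped_cos ?z"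
          using H(3) by (rule mult_left_mono)
        also have "\<dots> \<le> p' ?z"
          unfolding p'_half using QMF_nonneg[OF p] H(4) by simp
        finally show "H \<epsilon> / 2 \<le> p' ?z"
          using monoD[OF H(2) \<epsilon>] by simp
        show "min ?z (1 - ?z) = min y (1 - y) / 2"
          using y by (auto simp: min_def)
      qed
      show "0 \<le> H \<epsilon> / 2" "H \<epsilon> / 2 \<le> 1" for \<epsilon>
        using H(3)[of \<epsilon>] H(4)[of \<epsilon>] by auto
      show "1 / 2 ^ N < r"
        using N by (simp add: power_divide)
    qed (use x \<delta> in auto)
    have "(\<lambda>k. \<Prod>i<k. 1 - f i) \<longlonglongrightarrow> 0"
    \<comment> \<open>At level \<open>\<delta> / 2 ^ (N * Suc i)\<close> the logarithm is
      \<open>ln (c / \<delta>) + N * ln 2 * Suc i\<close>, affine in \<open>i\<close>. The constant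
      \<open>1 / 2 ^ N\<close> collects the factor 1/2 lost at each of the \<open>N\<close> steps of
      a block.\<close>
    proof (rule prod_one_minus_harmonic_tendsto_0[where a = "1 + ln (c / \<delta>)" and b = "N * ln 2" and C = "1 / 2 ^ N"])
      show "0 < 1 + ln (c / \<delta>)"
        using \<delta> c by (simp add: add_pos_nonneg)
      show "0 < N * ln 2"
        using \<open>0 < N\<close> by simp
      show "f i \<le> 1" for i
        unfolding f_def using H(3,4) by (intro power_le_one) (auto intro: order_trans[of _ 1])
      show "1 / 2 ^ N / (1 + ln (c / \<delta>) + N * ln 2 * real (Suc i)) \<le> f i" for i
      proof -
        let ?\<epsilon> = "\<delta> / 2 ^ (N * Suc i)"
        have "\<delta> * 1 \<le> c * 2 ^ (N * Suc i)"
          using \<delta> by (intro mult_mono) auto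
        then have "?\<epsilon> \<le> c"
          by (simp add: divide_le_eq)
        then have "H ?\<epsilon> ^ N = 1 / (1 + ln (c / ?\<epsilon>))"
          using \<delta> by (intro H(7)) auto
        also have "ln (c / ?\<epsilon>) = ln (c / \<delta>) + N * ln 2 * real (Suc i)"
        proof -
          have "ln (c / ?\<epsilon>) = ln (c / \<delta> * 2 ^ (N * Suc i))"
            by simp
          also have "\<dots> = ln (c / \<delta>) + real (N * Suc i) * ln 2"
            using \<delta> c by (subst ln_mult) (auto simp: ln_realpow simp del: mult_Suc_right)
          finally show ?thesis
            by (simp only: of_nat_mult mult_ac)
        qed
        finally show ?thesis
          by (simp add: f_def power_divide add.assoc mult.commute)
      qed
    qed simp
    then show "(\<lambda>k. survival p' {r..1-r} (k * N) x) \<longlonglongrightarrow> 0"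
      by (rule tendsto_sandwich[OF _ _ tendsto_const, rotated 2])
         (auto simp: survival_nonneg[OF \<open>QMF p'\<close>] le)
  qed
  ultimately show thesis
    using that by blast
qed

theorem theorem1:
  fixes B :: "real set"
  assumes "B \<subseteq> {0<..<1}" and "closed B" and "mult2_invariant B"
    and "\<exists>p. QMF p \<and> qmf_invariant p B"
  shows "\<exists>p'. QMF p' \<and> qmf_invariant p' B \<and>
    (AE x in lborel. x \<in> {0..1} \<longrightarrow>
      \<P>(\<xi> in qmf_law p' x. \<xi> \<longlonglongrightarrow> 0 \<or> \<xi> \<longlonglongrightarrow> 1) = 1)"
proof -
  obtain p where p: "QMF p" "qmf_invariant p B"
    using assms(4) by blast
  \<comment> \<open>The added orbit only makes the set nonempty, so that distances to it are meaningful.\<close>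
  define B' where "B' = B \<union> {1/3, 2/3}"
  have inv: "frac (2 * x) \<in> B'" if "x \<in> B'" for x
  proof (cases "x \<in> B")
    case True
    then have "frac (2 * x) \<in> B"
      using assms(3) unfolding mult2_invariant_def by blast
    then show ?thesis
      by (simp add: B'_def)
  next
    case False
    \<comment> \<open>Doubling modulo 1 exchanges 1/3 and 2/3.\<close>
    with that consider "x = 1/3" | "x = 2/3"
      by (auto simp: B'_def)
    then show ?thesis
    proof cases
      case 1
      then show ?thesis
        by (simp add: B'_def)
    next
      case 2
      then have "2 * x - 1/3 = 1"
        by simp
      then have "frac (2 * x) = 1/3"
        unfolding frac_unique_iff by simp
      then show ?thesis
        by (simp add: B'_def)
    qed
  qed
  have B': "closed B'" "B' \<subseteq> {0<..<1}" "B' \<noteq> {}"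
    using assms(1,2) by (auto simp: B'_def)
  obtain p' where p': "QMF p'"
    "\<And>x. x \<in> B' \<Longrightarrow> p' (x / 2) = p (x / 2) \<and> p' (x / 2 + 1 / 2) = p (x / 2 + 1 / 2)"
    "\<And>x. x \<in> {0..1} - B' \<Longrightarrow> \<P>(\<xi> in qmf_law p' x. \<xi> \<longlonglongrightarrow> 0 \<or> \<xi> \<longlonglongrightarrow> 1) = 1"
    using QMF_absorbing_modification[OF p(1) B' inv] by blast
  \<comment> \<open>Since \<open>B \<subseteq> B'\<close>, the two functions agree on the preimages
    of \<open>B\<close>.\<close>
  have "qmf_invariant p' B"
    using p' by (intro qmf_invariant_cong[OF p(1) p'(1) p(2)]) (simp add: B'_def)
  moreover have "AE x in lborel. x \<notin> B'"
    using doubling_invariant_null[OF B'(2,1) inv] by (rule AE_not_in)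
  then have "AE x in lborel. x \<in> {0..1} \<longrightarrow>
      \<P>(\<xi> in qmf_law p' x. \<xi> \<longlonglongrightarrow> 0 \<or> \<xi> \<longlonglongrightarrow> 1) = 1"
    by eventually_elim (use p'(3) in auto)
  ultimately show ?thesis
    using p'(1) by blast
qed

end
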